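(* For any profinite group $G$: (1) $\mathcal{S}(G)$ is either countable or of size $2^{w(G)}$; and (2) $\mathcal{N}(G)$ is either countable or of size $2^{w(G)}$.
   Context: $\mathcal{S}(G)$ is the set of closed subgroups of $G$ and $\mathcal{N}(G)$ is the set of closed normal subgroups of $G$. $w(G)$ is the weight of $G$: the least cardinality of a base for the topology of $G$. Countable means finite or countably infinite. *)

theory Defs
  imports "HOL-Analysis.Analysis" "HOL-Algebra.Coset"
begin

unbundle cardinal_syntax

locale topological_group = group G
  for G :: "('a, 'b) monoid_scheme" (structure) and T :: "'a topology" +
  assumes topspace_eq_carrier: "topspace T = carrier G"
    and continuous_mult: "continuous_map (prod_topology T T) T (\<lambda>(x, y). x \<otimes> y)"
    and continuous_inv: "continuous_map T T (\<lambda>x. inv x)"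

definition totally_disconnected_space :: "'a topology \<Rightarrow> bool" where
  "totally_disconnected_space T \<longleftrightarrow>
     (\<forall>x \<in> topspace T. connected_component_of_set T x = {x})"

locale profinite_group = topological_group +
  assumes compact: "compact_space T"
    and Hausdorff: "Hausdorff_space T"
    and totally_disconnected: "totally_disconnected_space T"

definition closed_subgroups :: "('a, 'b) monoid_scheme \<Rightarrow> 'a topology \<Rightarrow> 'a set set" where
  "closed_subgroups G T = {H. subgroup H G \<and> closedin T H}"

definition closed_normal_subgroups :: "('a, 'b) monoid_scheme \<Rightarrow> 'a topology \<Rightarrow> 'a set set" where
  "closed_normal_subgroups G T = {N. N \<lhd> G \<and> closedin T N}"

definition base_of_topology :: "'a topology \<Rightarrow> 'a set set \<Rightarrow> bool" where
  "base_of_topology T \<B> \<longleftrightarrow>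
     (\<forall>V \<in> \<B>. openin T V) \<and>
     (\<forall>U x. openin T U \<and> x \<in> U \<longrightarrow> (\<exists>V \<in> \<B>. x \<in> V \<and> V \<subseteq> U))"

text \<open>
  Cardinals are represented, as in the library, by minimal well-orders. The weight is the
  cardinal of a base of least cardinality; it does not depend on the chosen base up to
  \<open>=o\<close>, and such a base exists by \<open>minimal_base_exists\<close> below.
\<close>

definition weight :: "'a topology \<Rightarrow> 'a set rel" where
  "weight T = |SOME \<B>. base_of_topology T \<B> \<and>
     (\<forall>\<B>'. base_of_topology T \<B>' \<longrightarrow> |\<B>| \<le>o |\<B>'| )|"

lemma minimal_base_exists:
  "\<exists>\<B>. base_of_topology T \<B> \<and> (\<forall>\<B>'. base_of_topology T \<B>' \<longrightarrow> |\<B>| \<le>o |\<B>'| )"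
proof -
  let ?R = "card_of ` {\<B>. base_of_topology T \<B>}"
  have "base_of_topology T {U. openin T U}"
    by (auto simp: base_of_topology_def)
  then have "?R \<noteq> {}" by blast
  moreover have "\<forall>r \<in> ?R. Card_order r" by (auto simp: card_of_Card_order)
  ultimately have "\<exists>r \<in> ?R. \<forall>r' \<in> ?R. r \<le>o r'"
    by (rule exists_minim_Card_order)
  then show ?thesis by auto
qed

lemma weight_attained: "\<exists>\<B>. base_of_topology T \<B> \<and> weight T = |\<B>|"
  unfolding weight_def using someI_ex[OF minimal_base_exists[of T]] by blast

lemma weight_least: "base_of_topology T \<B> \<Longrightarrow> weight T \<le>o |\<B>|"
  unfolding weight_def using someI_ex[OF minimal_base_exists[of T]] by blast

end

theory Submission
  imports Defs
    "HOL-Library.Countable_Set_Type"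
    "HOL-Algebra.Free_Abelian_Groups"
    "HOL-Algebra.SndIsomorphismGrp"
    "HOL-Algebra.Zassenhaus"
begin

text \<open>
  The upper bound holds in any space: a closed set is determined by the members of a
  base that miss it, so there are at most \<open>2 ^ w\<close> closed sets. All the work
  is in the lower bound, and it is governed by the set \<open>L\<close> of open normal
  subgroups. The cosets of the members of \<open>L\<close> form a base, and each member has
  finitely many cosets, so \<open>w \<le> |L|\<close> when \<open>L\<close> is infinite.

  If \<open>L\<close> is countable, it contains a cofinal decreasing sequence \<open>U n\<close>, and a
  closed subgroup \<open>H\<close> is the intersection of its approximations \<open>U n <#> H\<close>, of which
  there are finitely many for each \<open>n\<close>. By compactness every coherent sequence of
  approximations comes from a closed subgroup (\<open>approximation_limit\<close>). So the closed
  subgroups, and likewise the closed normal ones, behave like the branches of a finitely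
  branching tree, and Cantor's scheme (\<open>cantor_scheme\<close>) shows that an uncountable set of
  this kind has at least \<open>2 ^ \<aleph>\<^sub>0\<close> elements.

  If \<open>L\<close> is uncountable, there are always \<open>2 ^ |L|\<close> closed normal subgroups, and
  these bound both families from below. It is enough to find \<open>|L|\<close> many open normal
  subgroups \<open>b\<close> that are independent, in the sense that no \<open>b\<close> contains the intersection
  of finitely many others: by compactness their subsets then have distinct intersections.
  Now \<open>L\<close> is a modular lattice in which only finitely many elements lie above a given one.
  Descending from \<open>G\<close> through maximal proper members reaches all of \<open>L\<close> in finitely many
  steps, so a counting argument valid for regular and singular cardinals alike
  (\<open>small_set_many_successors\<close>) gives a set \<open>V \<subseteq> L\<close> with \<open>|V| < |L|\<close> whose elements
  together have \<open>|L|\<close> many maximal proper subobjects in \<open>L\<close>. By modularity these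
  satisfy the Steinitz exchange property over \<open>V\<close> (\<open>span_below_exchange\<close>), so they have a
  basis. A set of size less than \<open>|L|\<close> spans fewer than \<open>|L|\<close> elements, or
  countably many, because a finite intersection lies below only finitely many members
  of \<open>L\<close>. So the basis has \<open>|L|\<close> elements, and it is independent.
\<close>

section \<open>Combinatorics of infinite sets\<close>

lemma countable_ordLeq_infinite:
  assumes "countable A" "infinite B"
  shows "|A| \<le>o |B|"
  using assms by (meson countable_card_of_nat infinite_iff_card_of_nat ordLeq_transitive)

text \<open>
  Think of \<open>E n x\<close> as the \<open>n\<close>-th approximation of \<open>x\<close>. After removal of the countably many
  points that have some approximation shared by countably many points only, every ball
  contains two points, and so branches. Following the branches gives an embedding of
  the Cantor space.
\<close>
lemma cantor_scheme:
  fixes E :: "nat \<Rightarrow> 'x \<Rightarrow> 'c"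
  assumes refine: "\<And>n x y. x \<in> X \<Longrightarrow> y \<in> X \<Longrightarrow> E (Suc n) x = E (Suc n) y \<Longrightarrow> E n x = E n y"
    and count: "\<And>n. countable (E n ` X)"
    and separate: "\<And>x y. x \<in> X \<Longrightarrow> y \<in> X \<Longrightarrow> (\<And>n. E n x = E n y) \<Longrightarrow> x = y"
    and complete: "\<And>x. (\<And>n. x n \<in> X) \<Longrightarrow> (\<And>n. E n (x (Suc n)) = E n (x n))
                    \<Longrightarrow> \<exists>y\<in>X. \<forall>n. E n y = E n (x n)"
    and unc: "uncountable X"
  shows "|UNIV :: nat set set| \<le>o |X|"
proof -
  have mono: "E n x = E n y" if "E m x = E m y" "n \<le> m" "x \<in> X" "y \<in> X" for n m x y
    using that(2,1) by (induction rule: dec_induct) (use refine that(3,4) in blast)+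
  define ball where "ball n c = {y \<in> X. E n y = c}" for n c
  define D where "D = (\<Union>n. \<Union>c \<in> {c \<in> E n ` X. countable (ball n c)}. ball n c)"
  have "countable D"
    unfolding D_def by (intro countable_UN countable_subset[OF _ count]) auto
  define P where "P = X - D"
  have PX: "P \<subseteq> X" by (auto simp: P_def)
  have "\<exists>y\<in>P. E n y = E n x \<and> y \<noteq> x" if "x \<in> P" for x n
  proof -
    have "uncountable (ball n (E n x))"
      using that by (force simp: P_def D_def ball_def)
    then have "uncountable (ball n (E n x) - D - {x})"
      using \<open>countable D\<close> by (simp add: uncountable_minus_countable)
    then obtain y where "y \<in> ball n (E n x) - D - {x}"
      by (metis countable_empty ex_in_conv)
    then show ?thesis by (auto simp: ball_def P_def)
  qed
  then obtain other where other: "\<And>x n. x \<in> P \<Longrightarrow> other x n \<in> P \<and> E n (other x n) = E n x \<and> other x n \<noteq> x"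
    by metis
  have "\<exists>m. E m (other x n) \<noteq> E m x" if "x \<in> P" for x n
    using separate other PX that by (meson subsetD)
  then obtain lev where lev: "\<And>x n. x \<in> P \<Longrightarrow> E (lev x n) (other x n) \<noteq> E (lev x n) x"
    by metis
  have lev_gt: "n < lev x n" if "x \<in> P" for x n
    using lev[OF that, of n] other[OF that, of n] mono[of n "other x n" x "lev x n"] PX that
    by (meson not_le subsetD)
  have "uncountable P"
    unfolding P_def using unc \<open>countable D\<close> by (rule uncountable_minus_countable)
  then obtain x0 where "x0 \<in> P" by (metis countable_empty ex_in_conv)
  \<comment> \<open>A node of the tree is a centre with the radius index of its ball. Bit \<open>k\<close> of the branch
    decides between the centre and a second point; the new index separates the two.\<close>
  define step where "step A k s = ((if k \<in> A then other (fst s) (snd s) else fst s), lev (fst s) (snd s))"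
    for A :: "nat set" and k :: nat and s :: "'x \<times> nat"
  define st where "st A = rec_nat (x0, 0) (step A)" for A
  have st0 [simp]: "st A 0 = (x0, 0)" and stSuc: "st A (Suc k) = step A k (st A k)" for A k
    by (simp_all add: st_def)
  define pt where "pt A k = fst (st A k)" for A k
  define n where "n A k = snd (st A k)" for A k
  have ptP: "pt A k \<in> P" for A k
    by (induction k) (auto simp: pt_def stSuc step_def \<open>x0 \<in> P\<close> other)
  have n_less: "n A k < n A (Suc k)" for A k
    using lev_gt[OF ptP] by (simp add: pt_def n_def stSuc step_def)
  have n_mono: "strict_mono (n A)" for A
    by (rule strict_monoI_Suc) (rule n_less)
  have n_ge: "k \<le> n A k" for A k
    using strict_mono_imp_increasing[OF n_mono] .
  have pt_Suc: "E (n A k) (pt A (Suc k)) = E (n A k) (pt A k)" for A k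
    using other[OF ptP[of A k], of "n A k"] by (auto simp: pt_def n_def stSuc step_def)
  have pt_later: "E (n A k) (pt A (k + j)) = E (n A k) (pt A k)" for A k j
  proof (induction j)
    case (Suc j)
    have "n A k \<le> n A (k + j)"
      using n_mono by (simp add: strict_mono_less_eq)
    then have "E (n A k) (pt A (Suc (k + j))) = E (n A k) (pt A (k + j))"
      using mono[OF pt_Suc[of A "k + j"]] ptP PX by blast
    with Suc show ?case by simp
  qed simp
  have "\<exists>y\<in>X. \<forall>k. E k y = E k (pt A k)" for A
  proof (rule complete)
    show "pt A k \<in> X" for k using ptP PX by blast
    show "E k (pt A (Suc k)) = E k (pt A k)" for k
      using mono[OF pt_Suc n_ge] ptP PX by blast
  qed
  then obtain f where fX: "\<And>A. f A \<in> X" and f: "\<And>A k. E k (f A) = E k (pt A k)"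
    by metis
  have f_pt: "E (n A k) (f A) = E (n A k) (pt A k)" for A k
  proof -
    obtain j where j: "n A k = k + j" using n_ge le_Suc_ex by blast
    show ?thesis using pt_later[of A k j] by (simp add: f j)
  qed
  have "inj f"
  proof (rule injI, rule ccontr)
    fix A B assume eq: "f A = f B" and "A \<noteq> B"
    then have "\<exists>k. (k \<in> A) \<noteq> (k \<in> B)" by blast
    \<comment> \<open>Up to their first difference the two branches pass through the same nodes.\<close>
    define k where "k = (LEAST k. (k \<in> A) \<noteq> (k \<in> B))"
    have k: "(k \<in> A) \<noteq> (k \<in> B)" and less: "\<And>i. i < k \<Longrightarrow> (i \<in> A) = (i \<in> B)"
      using LeastI_ex[OF \<open>\<exists>k. (k \<in> A) \<noteq> (k \<in> B)\<close>] not_less_Least unfolding k_def by blast+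
    have "i \<le> k \<Longrightarrow> st A i = st B i" for i
      by (induction i) (auto simp: stSuc step_def less)
    then have st_eq: "st A k = st B k" by simp
    define x where "x = pt A k"
    define l where "l = lev x (n A k)"
    have l: "n A (Suc k) = l" "n B (Suc k) = l"
      by (simp_all add: l_def x_def n_def pt_def stSuc step_def st_eq)
    have "E l (pt A (Suc k)) = E l (pt B (Suc k))"
      using f_pt[of A "Suc k"] f_pt[of B "Suc k"] by (simp add: l eq)
    moreover have "pt A (Suc k) = (if k \<in> A then other x (n A k) else x)"
      "pt B (Suc k) = (if k \<in> B then other x (n A k) else x)"
      by (simp_all add: x_def n_def pt_def stSuc step_def st_eq)
    ultimately have "E l (other x (n A k)) = E l x"
      using k by (auto split: if_splits)
    then show False
      using lev[OF ptP[of A k], of "n A k"] by (simp add: l_def x_def)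
  qed
  then show ?thesis
    using fX by (auto intro!: card_of_ordLeqI[of f])
qed

text \<open>
  For regular \<open>|X|\<close> a single \<open>v\<close> with \<open>|X|\<close> successors would do; for singular
  \<open>|X|\<close> it need not exist. If no small set works, all levels \<open>R n\<close> of the search
  from the root \<open>r\<close> are small. But for each \<open>n\<close> some \<open>v n\<close> has at least \<open>|R n|\<close> successors,
  since otherwise the whole of \<open>X\<close> would have size at most \<open>|R n|\<close>, and the countable set of
  these \<open>v n\<close> works after all.
\<close>
lemma small_set_many_successors:
  fixes C :: "'x \<Rightarrow> 'x set"
  assumes step: "\<And>v. v \<in> X \<Longrightarrow> C v \<subseteq> X" and "r \<in> X"
    and reach: "\<And>Y. r \<in> Y \<Longrightarrow> (\<And>v. v \<in> X \<Longrightarrow> v \<in> Y \<Longrightarrow> C v \<subseteq> Y) \<Longrightarrow> X \<subseteq> Y"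
    and unc: "uncountable X"
  obtains V where "V \<subseteq> X" "|V| <o |X|" "|X| \<le>o |\<Union>(C ` V)|"
proof -
  define R where "R = rec_nat {r} (\<lambda>_ Y. \<Union>(C ` Y))"
  have R0: "R 0 = {r}" and RSuc: "R (Suc n) = \<Union>(C ` R n)" for n
    by (simp_all add: R_def)
  have RX: "R n \<subseteq> X" for n
    by (induction n) (use \<open>r \<in> X\<close> step in \<open>auto simp: R0 RSuc\<close>)
  have X_R: "X \<subseteq> (\<Union>n. R n)"
  proof (rule reach)
    show "r \<in> (\<Union>n. R n)" using R0 by blast
    show "C v \<subseteq> (\<Union>n. R n)" if "v \<in> (\<Union>n. R n)" for v
    proof -
      obtain n where "v \<in> R n" using \<open>v \<in> (\<Union>n. R n)\<close> by blast
      then have "C v \<subseteq> R (Suc n)" by (auto simp: RSuc)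
      then show ?thesis by blast
    qed
  qed
  have inf: "infinite X" using unc countable_finite by blast
  have countable_small: "|Y| <o |X|" if "countable Y" for Y :: "'x set"
  proof (rule ccontr)
    assume "\<not> |Y| <o |X|"
    then have "|X| \<le>o |Y|" by simp
    then obtain f where "inj_on f X" "f ` X \<subseteq> Y" using card_of_ordLeq[of X Y] by blast
    then have "countable X" using that countable_subset countable_image_inj_on by metis
    then show False using unc by simp
  qed
  have "\<exists>V\<subseteq>X. |V| <o |X| \<and> |X| \<le>o |\<Union>(C ` V)|"
  proof (rule ccontr)
    assume *: "\<not> ?thesis"
    have no: "|\<Union>(C ` V)| <o |X|" if "V \<subseteq> X" "|V| <o |X|" for V
      using * that by (meson card_of_Well_order ordLess_or_ordLeq)
    have R_small: "|R n| <o |X|" for n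
    proof (induction n)
      case 0 show ?case by (auto simp: R0 intro: countable_small)
    next
      case (Suc n) then show ?case using no[OF RX] by (simp add: RSuc)
    qed
    have bound: "|X| \<le>o |Z|" if "infinite Z" "\<And>v. v \<in> X \<Longrightarrow> |C v| \<le>o |Z|" for Z :: "'x set"
    proof -
      have "|R n| \<le>o |Z|" for n
      proof (induction n)
        case 0 show ?case using that(1) by (auto simp: R0 intro: countable_ordLeq_infinite)
      next
        case (Suc n) then show ?case
          unfolding RSuc using that RX by (intro card_of_UNION_ordLeq_infinite) auto
      qed
      then have "|\<Union>n. R n| \<le>o |Z|"
        using that(1) by (intro card_of_UNION_ordLeq_infinite) (auto intro: countable_ordLeq_infinite)
      then show ?thesis using card_of_mono1[OF X_R] ordLeq_transitive by blast
    qed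
    \<comment> \<open>Adding \<open>N\<close> to a level makes it infinite, as the cardinal arithmetic requires.\<close>
    obtain N where N: "N \<subseteq> X" "infinite N" "countable N"
      using inf infinite_countable_subset'[OF inf] by blast
    have "\<exists>v\<in>X. |R n \<union> N| \<le>o |C v|" for n
    proof (rule ccontr)
      assume "\<not> ?thesis"
      then have "|C v| \<le>o |R n \<union> N|" if "v \<in> X" for v
        using that by (meson card_of_Well_order ordLess_imp_ordLeq ordLess_or_ordLeq)
      then have "|X| \<le>o |R n \<union> N|"
        using N by (intro bound) auto
      moreover have "|R n \<union> N| <o |X|"
        using R_small countable_small N inf by (intro card_of_Un_ordLess_infinite) auto
      ultimately show False using not_ordLess_ordLeq by blast
    qed
    then obtain v where v: "\<And>n. v n \<in> X" "\<And>n. |R n \<union> N| \<le>o |C (v n)|" by metis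
    define U where "U = \<Union>(C ` range v)"
    have *: "|R n \<union> N| \<le>o |U|" for n
      using v(2)[of n] card_of_mono1[of "C (v n)" U] ordLeq_transitive by (fastforce simp: U_def)
    have "|N| \<le>o |U|" using *[of 0] card_of_mono1[of N "R 0 \<union> N"] ordLeq_transitive by blast
    then have "infinite U" using N(2) card_of_ordLeq_finite by blast
    moreover have "|R n| \<le>o |U|" for n
      using *[of n] card_of_mono1[of "R n" "R n \<union> N"] ordLeq_transitive by blast
    ultimately have "|\<Union>n. R n| \<le>o |U|"
      by (intro card_of_UNION_ordLeq_infinite) (auto intro: countable_ordLeq_infinite)
    then have "|X| \<le>o |U|" using card_of_mono1[OF X_R] ordLeq_transitive by blast
    moreover have "|U| <o |X|"
      unfolding U_def using v(1) by (intro no countable_small) auto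
    ultimately show False using not_ordLess_ordLeq by blast
  qed
  then show ?thesis using that by blast
qed

text \<open>
  The matroid form of the existence of bases: Zorn's lemma yields a maximal independent
  set, because dependence is witnessed by finite sets, and exchange shows that it spans.
\<close>
lemma exchange_basis_exists:
  assumes mono: "\<And>A B. A \<subseteq> B \<Longrightarrow> cl A \<subseteq> cl B"
    and ext: "\<And>A. A \<subseteq> X \<Longrightarrow> A \<subseteq> cl A"
    and finitary: "\<And>A x. x \<in> cl A \<Longrightarrow> \<exists>F\<subseteq>A. finite F \<and> x \<in> cl F"
    and exchange: "\<And>A x y. A \<subseteq> X \<Longrightarrow> x \<in> X \<Longrightarrow> y \<in> X \<Longrightarrow> x \<in> cl (insert y A) \<Longrightarrow> x \<notin> cl A
                     \<Longrightarrow> y \<in> cl (insert x A)"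
  obtains B where "B \<subseteq> X" "\<And>b. b \<in> B \<Longrightarrow> b \<notin> cl (B - {b})" "X \<subseteq> cl B"
proof -
  define \<A> where "\<A> = {B. B \<subseteq> X \<and> (\<forall>b\<in>B. b \<notin> cl (B - {b}))}"
  have "\<exists>B\<in>\<A>. \<forall>B'\<in>\<A>. B \<subseteq> B' \<longrightarrow> B' = B"
  proof (rule subset_Zorn_nonempty)
    show "\<A> \<noteq> {}" by (auto simp: \<A>_def)
    fix \<C> assume "\<C> \<noteq> {}" and chain: "subset.chain \<A> \<C>"
    then have sub: "\<C> \<subseteq> \<A>" by (simp add: subset.chain_def)
    have "b \<notin> cl (\<Union>\<C> - {b})" if "b \<in> \<Union>\<C>" for b
    proof
      assume "b \<in> cl (\<Union>\<C> - {b})"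
      then obtain F where F: "F \<subseteq> \<Union>\<C> - {b}" "finite F" "b \<in> cl F"
        using finitary by blast
      have "finite (insert b F)" "insert b F \<subseteq> \<Union>\<C>" using F that by auto
      then obtain D where D: "D \<in> \<C>" "insert b F \<subseteq> D"
        using finite_subset_Union_chain[OF _ _ \<open>\<C> \<noteq> {}\<close> chain] by metis
      then have "F \<subseteq> D - {b}" using F by blast
      then have "b \<in> cl (D - {b})" using mono F(3) by blast
      then show False using D sub by (auto simp: \<A>_def)
    qed
    then show "\<Union>\<C> \<in> \<A>" using sub by (auto simp: \<A>_def)
  qed
  then obtain B where BA: "B \<in> \<A>" and max: "\<And>B'. B' \<in> \<A> \<Longrightarrow> B \<subseteq> B' \<Longrightarrow> B' = B"
    by metis
  then have B: "B \<subseteq> X" "\<And>b. b \<in> B \<Longrightarrow> b \<notin> cl (B - {b})"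
    by (simp_all add: \<A>_def)
  have "x \<in> cl B" if "x \<in> X" for x
  proof (rule ccontr)
    assume x: "x \<notin> cl B"
    then have "x \<notin> B" using ext[OF B(1)] by blast
    have "b \<notin> cl (insert x B - {b})" if b: "b \<in> insert x B" for b
    proof (cases "b = x")
      case True then show ?thesis using x \<open>x \<notin> B\<close> by simp
    next
      case False
      then have bB: "b \<in> B" and eq: "insert x B - {b} = insert x (B - {b})" using b by auto
      have "B - {b} \<subseteq> X" "b \<in> X" using B(1) bB by auto
      with exchange[of "B - {b}" b x] \<open>x \<in> X\<close> B(2)[OF bB] x bB show ?thesis
        unfolding eq by (auto simp: insert_absorb)
    qed
    then have "insert x B \<in> \<A>" using B(1) \<open>x \<in> X\<close> by (auto simp: \<A>_def)
    then show False using max \<open>x \<notin> B\<close> by blast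
  qed
  with B that show ?thesis by blast
qed

section \<open>Open normal subgroups of a profinite group\<close>

lemma card_closed_sets_le_Pow_base:
  assumes "base_of_topology T \<B>"
  shows "|{C. closedin T C}| \<le>o |Pow \<B>|"
proof (rule card_of_ordLeqI)
  define f where "f C = {V \<in> \<B>. V \<inter> C = {}}" for C
  show "f C \<in> Pow \<B>" for C by (auto simp: f_def)
  have complement: "topspace T - C = \<Union>(f C)" if "closedin T C" for C
  proof
    have "openin T (topspace T - C)" using that by blast
    then show "topspace T - C \<subseteq> \<Union>(f C)"
      using assms unfolding base_of_topology_def f_def by fastforce
    show "\<Union>(f C) \<subseteq> topspace T - C"
      using assms openin_subset unfolding base_of_topology_def f_def by blast
  qed
  show "inj_on f {C. closedin T C}"
  proof (rule inj_onI, clarify)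
    fix C D assume "closedin T C" "closedin T D" "f C = f D"
    then show "C = D" using complement closedin_subset by (metis double_diff order_refl)
  qed
qed

context topological_group
begin

lemma topspace_carrier [simp]: "topspace T = carrier G"
  by (rule topspace_eq_carrier)

lemma continuous_translate:
  assumes "g \<in> carrier G"
  shows "continuous_map T T (\<lambda>x. x \<otimes> g)"
proof -
  have "continuous_map T (prod_topology T T) (\<lambda>x. (x, g))"
    using assms by (intro continuous_map_pairedI) auto
  from continuous_map_compose[OF this continuous_mult] show ?thesis
    by (simp add: comp_def)
qed

lemma r_coset_vimage:
  assumes "W \<subseteq> carrier G" "g \<in> carrier G"
  shows "W #> g = {x \<in> topspace T. x \<otimes> inv g \<in> W}"
proof (intro equalityI subsetI)
  fix x assume "x \<in> W #> g"
  then show "x \<in> {x \<in> topspace T. x \<otimes> inv g \<in> W}"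
    using assms by (auto simp: r_coset_def m_assoc)
next
  fix x assume "x \<in> {x \<in> topspace T. x \<otimes> inv g \<in> W}"
  then have "x = (x \<otimes> inv g) \<otimes> g" "x \<otimes> inv g \<in> W"
    using assms by (auto simp: m_assoc)
  then show "x \<in> W #> g" by (auto simp: r_coset_def)
qed

lemma openin_r_coset:
  assumes W: "openin T W" and g: "g \<in> carrier G"
  shows "openin T (W #> g)"
  using openin_continuous_map_preimage[OF continuous_translate[of "inv g"] W] g
    openin_subset[OF W] by (simp add: r_coset_vimage)

lemma closedin_r_coset:
  assumes W: "closedin T W" and g: "g \<in> carrier G"
  shows "closedin T (W #> g)"
  using closedin_continuous_map_preimage[OF continuous_translate[of "inv g"] W] g
    closedin_subset[OF W] by (simp add: r_coset_vimage)

lemma open_subgroupI: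
  assumes H: "subgroup H G" and U: "openin T U" "\<one> \<in> U" "U \<subseteq> H"
  shows "openin T H"
proof -
  have HG: "H \<subseteq> carrier G" using subgroup.subset[OF H] .
  have "H = (\<Union>h\<in>H. U #> h)"
  proof (intro equalityI subsetI)
    fix h assume "h \<in> H"
    then show "h \<in> (\<Union>h\<in>H. U #> h)"
      using U(2) HG by (force simp: r_coset_def)
  next
    fix x assume "x \<in> (\<Union>h\<in>H. U #> h)"
    then show "x \<in> H"
      using U(3) subgroup.m_closed[OF H] by (auto simp: r_coset_def)
  qed
  then show ?thesis
    using openin_r_coset[OF U(1)] HG openin_Union[of "(\<lambda>h. U #> h) ` H" T] by auto
qed

lemma open_subgroup_closed:
  assumes H: "subgroup H G" and "openin T H"
  shows "closedin T H"
proof -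
  have HG: "H \<subseteq> carrier G" using subgroup.subset[OF H] .
  have "carrier G - H = (\<Union>g\<in>carrier G - H. H #> g)"
  proof (intro equalityI subsetI)
    fix g assume "g \<in> carrier G - H"
    then show "g \<in> (\<Union>g\<in>carrier G - H. H #> g)"
      using rcos_self[OF _ H] by blast
  next
    fix x assume "x \<in> (\<Union>g\<in>carrier G - H. H #> g)"
    then obtain g h where gh: "g \<in> carrier G" "g \<notin> H" "h \<in> H" "x = h \<otimes> g"
      by (auto simp: r_coset_def)
    have "x \<notin> H"
    proof
      assume "x \<in> H"
      then have "inv h \<otimes> x \<in> H"
        using gh H by (simp add: subgroup.m_closed subgroup.m_inv_closed)
      moreover have "inv h \<otimes> x = g"
        using gh HG by (simp add: m_assoc[symmetric] subsetD)
      ultimately show False using gh by simp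
    qed
    then show "x \<in> carrier G - H" using gh HG by auto
  qed
  then have "openin T (carrier G - H)"
    using openin_r_coset[OF assms(2)] openin_Union[of "(\<lambda>h. H #> h) ` (carrier G - H)" T] by auto
  then show ?thesis using HG by (simp add: closedin_def)
qed

end

context profinite_group
begin

text \<open>
  The tube lemma: the exceptional set is the projection of a closed set along a
  compact factor. It produces open subgroups out of clopen sets, and normal ones out of
  arbitrary ones.
\<close>
lemma openin_forall_closed:
  assumes K: "closedin T K" and W: "openin T W"
    and f: "continuous_map (prod_topology T T) T f"
  shows "openin T {x \<in> carrier G. \<forall>k\<in>K. f (x, k) \<in> W}"
proof -
  define C where "C = {p \<in> topspace (prod_topology T T). f p \<in> topspace T - W} \<inter> (topspace T \<times> K)"
  have "closedin (prod_topology T T) {p \<in> topspace (prod_topology T T). f p \<in> topspace T - W}"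
    using closedin_continuous_map_preimage[OF f] W by blast
  moreover have "closedin (prod_topology T T) (topspace T \<times> K)"
    using K closedin_topspace[of T] by (simp add: closedin_prod_Times_iff del: closedin_topspace)
  ultimately have "closedin (prod_topology T T) C"
    unfolding C_def by (rule closedin_Int)
  then have "closedin T (fst ` C)"
    using closed_map_fst[OF compact, of T] by (simp add: closed_map_def)
  then have "openin T (topspace T - fst ` C)" by blast
  moreover have "topspace T - fst ` C = {x \<in> carrier G. \<forall>k\<in>K. f (x, k) \<in> W}"
  proof -
    have KG: "K \<subseteq> carrier G" using closedin_subset[OF K] by simp
    have fG: "f (x, k) \<in> carrier G" if "x \<in> carrier G" "k \<in> carrier G" for x k
      using continuous_map_image_subset_topspace[OF f] that by fastforce
    have "x \<in> fst ` C \<longleftrightarrow> (\<exists>k\<in>K. f (x, k) \<notin> W)" if x: "x \<in> carrier G" for x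
    proof
      assume "x \<in> fst ` C"
      then obtain k where "(x, k) \<in> C" by auto
      then show "\<exists>k\<in>K. f (x, k) \<notin> W" by (auto simp: C_def)
    next
      assume "\<exists>k\<in>K. f (x, k) \<notin> W"
      then obtain k where k: "k \<in> K" "f (x, k) \<notin> W" by blast
      then have "(x, k) \<in> C" using KG x fG by (simp add: C_def subsetD)
      then show "x \<in> fst ` C" by (rule image_eqI[rotated]) simp
    qed
    then show ?thesis by auto
  qed
  ultimately show ?thesis by simp
qed

text \<open>
  In a compact Hausdorff space components are intersections of clopen sets, so the
  component \<open>{\<one>}\<close> can be separated from the compact complement of \<open>W\<close>.
\<close>
lemma clopen_neighbourhood_one:
  assumes W: "openin T W" "\<one> \<in> W"
  obtains U where "openin T U" "closedin T U" "\<one> \<in> U" "U \<subseteq> W"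
proof -
  let ?Q = "quasi_component_of_set T \<one>"
  have "?Q = {\<one>}"
    using quasi_eq_connected_component_of[of T \<one>] compact Hausdorff totally_disconnected
    by (simp add: totally_disconnected_space_def)
  moreover have "?Q \<in> quasi_components_of T" by (simp add: quasi_components_of_def)
  moreover have "compactin T (topspace T - W)"
    using W compact closedin_compact_space by blast
  ultimately have "separated_between T {\<one>} (topspace T - W)"
    using separated_between_quasi_component_compact[of "{\<one>}" T "topspace T - W"] W
    by (simp add: disjnt_def)
  then obtain U V where UV: "openin T U" "openin T V" "U \<union> V = topspace T" "disjnt U V"
      "\<one> \<in> U" "topspace T - W \<subseteq> V"
    by (auto simp: separated_between_def)
  have "U = topspace T - V" using UV by (auto simp: disjnt_def)
  then have "closedin T U" using UV(2) by blast
  moreover have "U \<subseteq> W" using UV by (auto simp: disjnt_def)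
  ultimately show ?thesis using that UV by blast
qed

text \<open>The stabiliser of a clopen neighbourhood \<open>U\<close> of \<open>\<one>\<close> under left
  translation is an open subgroup, and it lies in \<open>U\<close> since \<open>\<one> \<in> U\<close>.\<close>
lemma open_subgroup_neighbourhood_one:
  assumes W: "openin T W" "\<one> \<in> W"
  obtains H where "subgroup H G" "openin T H" "H \<subseteq> W"
proof -
  obtain U where U: "openin T U" "closedin T U" "\<one> \<in> U" "U \<subseteq> W"
    using clopen_neighbourhood_one[OF W] by blast
  have UG: "U \<subseteq> carrier G" using openin_subset[OF U(1)] by simp
  define H where "H = {x \<in> carrier G. (\<forall>u\<in>U. x \<otimes> u \<in> U) \<and> (\<forall>u\<in>U. inv x \<otimes> u \<in> U)}"
  have "continuous_map (prod_topology T T) T (\<lambda>p. inv (fst p))"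
    using continuous_map_compose[OF continuous_map_fst continuous_inv] by (simp add: comp_def)
  then have "continuous_map (prod_topology T T) (prod_topology T T) (\<lambda>p. (inv (fst p), snd p))"
    by (intro continuous_map_pairedI) (simp_all add: continuous_map_snd)
  from continuous_map_compose[OF this continuous_mult]
  have "continuous_map (prod_topology T T) T (\<lambda>p. inv (fst p) \<otimes> snd p)"
    by (simp add: comp_def)
  from openin_Int[OF openin_forall_closed[OF U(2,1) continuous_mult] openin_forall_closed[OF U(2,1) this]]
  have "openin T ({x \<in> carrier G. \<forall>u\<in>U. x \<otimes> u \<in> U} \<inter> {x \<in> carrier G. \<forall>u\<in>U. inv x \<otimes> u \<in> U})"
    by simp
  also have "{x \<in> carrier G. \<forall>u\<in>U. x \<otimes> u \<in> U} \<inter> {x \<in> carrier G. \<forall>u\<in>U. inv x \<otimes> u \<in> U} = H"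
    by (auto simp: H_def)
  finally have "openin T H" .
  moreover have "subgroup H G"
  proof (rule subgroupI)
    show "H \<subseteq> carrier G" by (auto simp: H_def)
    have "\<one> \<in> H" using UG by (auto simp: H_def)
    then show "H \<noteq> {}" by blast
    show "inv x \<in> H" if "x \<in> H" for x using that by (auto simp: H_def)
    show "x \<otimes> y \<in> H" if "x \<in> H" "y \<in> H" for x y
      using that UG by (auto simp: H_def m_assoc inv_mult_group subsetD)
  qed
  moreover have "H \<subseteq> U"
    using U(3) by (auto simp: H_def)
  ultimately show ?thesis using that U(4) by blast
qed

definition open_normals :: "'a set set" where
  "open_normals = {N. N \<lhd> G \<and> openin T N}"

text \<open>The intersection of the conjugates of an open subgroup remains open, by
  compactness.\<close>
lemma open_normal_neighbourhood_one:
  assumes W: "openin T W" "\<one> \<in> W"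
  obtains N where "N \<in> open_normals" "N \<subseteq> W"
proof -
  obtain H where H: "subgroup H G" "openin T H" "H \<subseteq> W"
    using open_subgroup_neighbourhood_one[OF W] by blast
  define N where "N = {x \<in> carrier G. \<forall>g\<in>carrier G. g \<otimes> x \<otimes> inv g \<in> H}"
  have "continuous_map (prod_topology T T) T (\<lambda>p. inv (snd p))"
    using continuous_map_compose[OF continuous_map_snd continuous_inv] by (simp add: comp_def)
  moreover have "continuous_map (prod_topology T T) T (\<lambda>p. snd p \<otimes> fst p)"
  proof -
    have "continuous_map (prod_topology T T) (prod_topology T T) (\<lambda>p. (snd p, fst p))"
      by (intro continuous_map_pairedI) (simp_all add: continuous_map_snd continuous_map_fst)
    from continuous_map_compose[OF this continuous_mult] show ?thesis by (simp add: comp_def)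
  qed
  ultimately have "continuous_map (prod_topology T T) (prod_topology T T) (\<lambda>p. (snd p \<otimes> fst p, inv (snd p)))"
    by (intro continuous_map_pairedI)
  from continuous_map_compose[OF this continuous_mult]
  have "continuous_map (prod_topology T T) T (\<lambda>p. snd p \<otimes> fst p \<otimes> inv (snd p))"
    by (simp add: comp_def)
  moreover have "closedin T (carrier G)" using closedin_topspace[of T] by simp
  ultimately have "openin T N"
    using openin_forall_closed[OF _ H(2)] by (fastforce simp: N_def)
  have HG: "H \<subseteq> carrier G" using subgroup.subset[OF H(1)] .
  have sub: "subgroup N G"
  proof (rule subgroupI)
    show "N \<subseteq> carrier G" by (auto simp: N_def)
    have "\<one> \<in> N" using subgroup.one_closed[OF H(1)] by (auto simp: N_def)
    then show "N \<noteq> {}" by blast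
    show "inv x \<in> N" if "x \<in> N" for x
    proof -
      have "g \<otimes> inv x \<otimes> inv g = inv (g \<otimes> x \<otimes> inv g)" if "g \<in> carrier G" for g
        using that \<open>x \<in> N\<close> by (simp add: N_def inv_mult_group m_assoc)
      then show ?thesis using that subgroup.m_inv_closed[OF H(1)] by (auto simp: N_def)
    qed
    show "x \<otimes> y \<in> N" if "x \<in> N" "y \<in> N" for x y
    proof -
      have "g \<otimes> (x \<otimes> y) \<otimes> inv g = (g \<otimes> x \<otimes> inv g) \<otimes> (g \<otimes> y \<otimes> inv g)" if "g \<in> carrier G" for g
      proof -
        have "x \<in> carrier G" "y \<in> carrier G" using \<open>x \<in> N\<close> \<open>y \<in> N\<close> by (auto simp: N_def)
        then show ?thesis using that by (simp add: m_assoc inv_solve_left)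
      qed
      then show ?thesis using that subgroup.m_closed[OF H(1)] by (auto simp: N_def)
    qed
  qed
  have "N \<lhd> G"
  proof (rule normal_invI[OF sub])
    fix x h assume xh: "x \<in> carrier G" "h \<in> N"
    have "g \<otimes> (x \<otimes> h \<otimes> inv x) \<otimes> inv g = (g \<otimes> x) \<otimes> h \<otimes> inv (g \<otimes> x)" if "g \<in> carrier G" for g
      using that xh by (simp add: N_def inv_mult_group m_assoc)
    then show "x \<otimes> h \<otimes> inv x \<in> N" using xh by (auto simp: N_def)
  qed
  moreover have "N \<subseteq> H"
  proof
    fix x assume "x \<in> N"
    then have "x \<in> carrier G" "\<one> \<otimes> x \<otimes> inv \<one> \<in> H" unfolding N_def by blast+
    then show "x \<in> H" by simp
  qed
  ultimately show ?thesis using that \<open>openin T N\<close> H(3) by (auto simp: open_normals_def)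
qed

lemma open_normalsD:
  assumes "N \<in> open_normals"
  shows "N \<lhd> G" "subgroup N G" "openin T N" "closedin T N" "N \<subseteq> carrier G"
proof -
  show N: "N \<lhd> G" "openin T N" using assms by (simp_all add: open_normals_def)
  show "subgroup N G" using normal_imp_subgroup[OF N(1)] .
  with N(2) show "closedin T N" "N \<subseteq> carrier G"
    by (simp_all add: open_subgroup_closed subgroup.subset)
qed

lemma carrier_open_normal: "carrier G \<in> open_normals"
proof -
  have "carrier G \<lhd> G" by (rule normal_invI[OF subgroup_self]) simp
  then show ?thesis using openin_topspace[of T] by (simp add: open_normals_def)
qed

lemma Int_open_normal: "M \<in> open_normals \<Longrightarrow> N \<in> open_normals \<Longrightarrow> M \<inter> N \<in> open_normals"
  by (simp add: open_normals_def normal_subgroup_intersect openin_Int)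

lemma finite_Inter_open_normal:
  assumes "finite F" "F \<subseteq> open_normals"
  shows "carrier G \<inter> \<Inter>F \<in> open_normals"
  using assms
proof (induction F)
  case empty then show ?case by (simp add: carrier_open_normal)
next
  case (insert M F)
  have "carrier G \<inter> \<Inter>(insert M F) = M \<inter> (carrier G \<inter> \<Inter>F)" by auto
  then show ?case using insert Int_open_normal by auto
qed

lemma set_mult_open_normal:
  assumes "M \<in> open_normals" "N \<in> open_normals"
  shows "M <#> N \<in> open_normals"
proof -
  note D = open_normalsD[OF assms(1)] open_normalsD[OF assms(2)]
  have norm: "M <#> N \<lhd> G" using normal_subgroup_set_mult_closed D by blast
  have "M \<subseteq> M <#> N"
    using D subgroup.one_closed[of N G] by (force simp: set_mult_def)
  then have "openin T (M <#> N)"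
    using open_subgroupI[OF normal_imp_subgroup[OF norm] D(3)] subgroup.one_closed[OF D(2)] by blast
  with norm show ?thesis by (simp add: open_normals_def)
qed

lemma finite_rcosets_open:
  assumes H: "subgroup H G" "openin T H"
  shows "finite (rcosets H)"
proof -
  have op: "openin T C" if "C \<in> rcosets H" for C
    using that openin_r_coset[OF H(2)] by (auto simp: RCOSETS_def)
  obtain \<F> where \<F>: "finite \<F>" "\<F> \<subseteq> rcosets H" "carrier G \<subseteq> \<Union>\<F>"
    using compact op rcosets_part_G[OF H(1)] unfolding compact_space_alt
    by (metis equalityE topspace_carrier)
  have "C \<in> \<F>" if C: "C \<in> rcosets H" for C
  proof -
    obtain x where x: "x \<in> carrier G" "C = H #> x" using C by (auto simp: RCOSETS_def)
    then have "x \<in> C" using rcos_self H by blast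
    obtain D where "D \<in> \<F>" "x \<in> D" using \<F> x by blast
    then have "C = D"
      using rcos_disjoint[OF H(1)] C \<F>(2) \<open>x \<in> C\<close> unfolding pairwise_def disjnt_def by blast
    then show ?thesis using \<open>D \<in> \<F>\<close> by simp
  qed
  then have "rcosets H \<subseteq> \<F>" ..
  then show ?thesis using \<F>(1) by (rule finite_subset)
qed

text \<open>An overgroup of \<open>N\<close> is a union of some of the finitely many cosets of \<open>N\<close>.\<close>
lemma finite_overgroups:
  assumes N: "N \<in> open_normals"
  shows "finite {H. subgroup H G \<and> N \<subseteq> H}"
proof (rule inj_on_finite)
  define f where "f H = {C \<in> rcosets N. C \<subseteq> H}" for H
  note D = open_normalsD[OF N]
  have *: "\<Union>(f H) = H" if H: "subgroup H G" "N \<subseteq> H" for H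
  proof
    show "\<Union>(f H) \<subseteq> H" by (auto simp: f_def)
    show "H \<subseteq> \<Union>(f H)"
    proof
      fix x assume x: "x \<in> H"
      then have xG: "x \<in> carrier G" using subgroup.subset[OF H(1)] by blast
      have "N #> x \<subseteq> H"
        using x H subgroup.m_closed[OF H(1)] by (auto simp: r_coset_def)
      then have "N #> x \<in> f H" using xG by (auto simp: f_def RCOSETS_def)
      then show "x \<in> \<Union>(f H)" using rcos_self[OF xG D(2)] by blast
    qed
  qed
  show "inj_on f {H. subgroup H G \<and> N \<subseteq> H}"
    by (rule inj_onI) (metis (mono_tags, lifting) * mem_Collect_eq)
  show "f ` {H. subgroup H G \<and> N \<subseteq> H} \<subseteq> Pow (rcosets N)"
    by (auto simp: f_def)
  show "finite (Pow (rcosets N))" using finite_rcosets_open D by simp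
qed

lemma rcosets_base: "base_of_topology T (\<Union>N\<in>open_normals. rcosets N)"
  unfolding base_of_topology_def
proof (intro conjI ballI allI impI)
  fix V assume "V \<in> (\<Union>N\<in>open_normals. rcosets N)"
  then obtain N x where "N \<in> open_normals" "x \<in> carrier G" "V = N #> x"
    by (auto simp: RCOSETS_def)
  then show "openin T V" by (simp add: openin_r_coset open_normalsD(3))
next
  fix U x assume Ux: "openin T U \<and> x \<in> U"
  then have xG: "x \<in> carrier G" using openin_subset[of T U] by auto
  have UG: "U \<subseteq> carrier G" using Ux openin_subset[of T U] by simp
  have "openin T (U #> inv x)" using openin_r_coset Ux xG by simp
  moreover have "\<one> \<in> U #> inv x" using Ux xG by (force simp: r_coset_def)
  ultimately obtain N where N: "N \<in> open_normals" "N \<subseteq> U #> inv x"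
    using open_normal_neighbourhood_one by blast
  have "N #> x \<subseteq> U"
  proof
    fix y assume "y \<in> N #> x"
    then obtain u where "u \<in> U" "y = (u \<otimes> inv x) \<otimes> x" using N(2) by (auto simp: r_coset_def)
    then show "y \<in> U" using UG xG by (auto simp: m_assoc subsetD)
  qed
  moreover have "x \<in> N #> x" using rcos_self xG open_normalsD(2)[OF N(1)] by blast
  ultimately show "\<exists>V\<in>\<Union>N\<in>open_normals. rcosets N. x \<in> V \<and> V \<subseteq> U"
    using N(1) xG by (auto simp: RCOSETS_def)
qed

lemma weight_le_open_normals:
  assumes "infinite B" "|open_normals| \<le>o |B|"
  shows "weight T \<le>o |B|"
proof -
  have "|\<Union>N\<in>open_normals. rcosets N| \<le>o |B|"
  proof (rule card_of_UNION_ordLeq_infinite[OF assms], rule ballI)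
    fix N assume "N \<in> open_normals"
    then have "finite (rcosets N)" by (simp add: finite_rcosets_open open_normalsD)
    then show "|rcosets N| \<le>o |B|"
      using assms(1) by (simp add: countable_ordLeq_infinite countable_finite)
  qed
  then show ?thesis using weight_least[OF rcosets_base] ordLeq_transitive by blast
qed

section \<open>Closed subgroups and their approximations\<close>

lemma closed_normal_subgroupsI:
  assumes "H \<in> closed_subgroups G T" "\<And>g h. g \<in> carrier G \<Longrightarrow> h \<in> H \<Longrightarrow> g \<otimes> h \<otimes> inv g \<in> H"
  shows "H \<in> closed_normal_subgroups G T"
  using assms by (simp add: closed_subgroups_def closed_normal_subgroups_def normal_invI)

lemma closed_normal_subset: "closed_normal_subgroups G T \<subseteq> closed_subgroups G T"
  by (auto simp: closed_subgroups_def closed_normal_subgroups_def normal_imp_subgroup)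

lemma Inter_closed_subgroups:
  assumes "\<H> \<subseteq> closed_subgroups G T" "\<H> \<noteq> {}"
  shows "\<Inter>\<H> \<in> closed_subgroups G T"
  using assms by (auto simp: closed_subgroups_def intro!: subgroups_Inter closedin_Inter)

lemma Inter_closed_normal_subgroups:
  assumes "\<H> \<subseteq> closed_normal_subgroups G T" "\<H> \<noteq> {}"
  shows "\<Inter>\<H> \<in> closed_normal_subgroups G T"
proof (rule closed_normal_subgroupsI)
  show "\<Inter>\<H> \<in> closed_subgroups G T"
    using assms closed_normal_subset by (intro Inter_closed_subgroups) auto
  fix g h assume "g \<in> carrier G" "h \<in> \<Inter>\<H>"
  then show "g \<otimes> h \<otimes> inv g \<in> \<Inter>\<H>"
    using assms(1) normal_inv_iff unfolding closed_normal_subgroups_def by blast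
qed

lemma set_mult_open_normal_closed_subgroup:
  assumes N: "N \<in> open_normals" and H: "H \<in> closed_subgroups G T"
  shows "N <#> H \<in> closed_subgroups G T" and "N \<subseteq> N <#> H"
proof -
  note D = open_normalsD[OF N]
  have subH: "subgroup H G" using H by (simp add: closed_subgroups_def)
  have sub: "subgroup (N <#> H) G" by (rule mult_norm_subgroup[OF D(1) subH])
  show NH: "N \<subseteq> N <#> H"
    using D subgroup.one_closed[OF subH] by (force simp: set_mult_def)
  have "openin T (N <#> H)"
    using open_subgroupI[OF sub D(3) _ NH] subgroup.one_closed[OF D(2)] by blast
  then show "N <#> H \<in> closed_subgroups G T"
    using sub by (simp add: closed_subgroups_def open_subgroup_closed)
qed

lemma set_mult_open_normal_closed_normal:
  assumes N: "N \<in> open_normals" and H: "H \<in> closed_normal_subgroups G T"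
  shows "N <#> H \<in> closed_normal_subgroups G T"
proof -
  have "N <#> H \<in> closed_subgroups G T"
    using assms closed_normal_subset set_mult_open_normal_closed_subgroup by blast
  moreover have "N <#> H \<lhd> G"
    using H open_normalsD(1)[OF N] by (simp add: closed_normal_subgroups_def normal_subgroup_set_mult_closed)
  ultimately show ?thesis
    by (simp add: closed_subgroups_def closed_normal_subgroups_def)
qed

lemma set_mult_absorb:
  assumes M: "M \<in> open_normals" and N: "N \<in> open_normals" and "M \<subseteq> N" "H \<subseteq> carrier G"
  shows "N <#> (M <#> H) = N <#> H"
proof -
  note DM = open_normalsD[OF M] and DN = open_normalsD[OF N]
  have "N <#> M = N"
  proof
    show "N <#> M \<subseteq> N"
      using subgroup.m_closed[OF DN(2)] \<open>M \<subseteq> N\<close> by (auto simp: set_mult_def)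
    show "N \<subseteq> N <#> M"
      using subgroup.one_closed[OF DM(2)] DN(5) by (force simp: set_mult_def)
  qed
  then show ?thesis
    using set_mult_assoc[OF DN(5) DM(5) \<open>H \<subseteq> carrier G\<close>] by simp
qed

text \<open>A point outside \<open>H\<close> has a basic neighbourhood \<open>N #> x\<close> that misses \<open>H\<close>, and
  then \<open>x \<notin> N <#> H\<close>. So a closed subgroup is determined by its approximations.\<close>
lemma closed_subgroup_approx:
  assumes H: "H \<in> closed_subgroups G T" and x: "x \<in> carrier G" "\<And>N. N \<in> open_normals \<Longrightarrow> x \<in> N <#> H"
  shows "x \<in> H"
proof (rule ccontr)
  assume "x \<notin> H"
  have HG: "H \<subseteq> carrier G" using H closedin_subset[of T H] by (simp add: closed_subgroups_def)
  have "openin T (carrier G - H)"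
    using H openin_closedin_eq[of T] closedin_def[of T H] by (simp add: closed_subgroups_def)
  then obtain V where V: "V \<in> (\<Union>N\<in>open_normals. rcosets N)" "x \<in> V" "V \<subseteq> carrier G - H"
    using rcosets_base \<open>x \<notin> H\<close> x(1) unfolding base_of_topology_def by blast
  then obtain N where N: "N \<in> open_normals" "V \<in> rcosets N" by blast
  note D = open_normalsD[OF N(1)]
  obtain n h where nh: "n \<in> N" "h \<in> H" "x = n \<otimes> h"
    using x(2)[OF N(1)] by (auto simp: set_mult_def)
  obtain y where y: "y \<in> carrier G" "V = N #> y" using N(2) by (auto simp: RCOSETS_def)
  have V_eq: "V = N #> x"
    using repr_independence[of x N y] V(2) y D(2) by simp
  have "h = inv n \<otimes> x"
    using nh D(5) HG by (simp add: m_assoc[symmetric] subsetD)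
  then have "h \<in> V"
    using subgroup.m_inv_closed[OF D(2) nh(1)] by (auto simp: V_eq r_coset_def)
  then show False using V(3) nh(2) by blast
qed

lemma cofinal_sequence:
  assumes "countable open_normals"
  obtains U :: "nat \<Rightarrow> 'a set" where
    "\<And>n. U n \<in> open_normals" "decseq U" "\<And>N. N \<in> open_normals \<Longrightarrow> \<exists>n. U n \<subseteq> N"
proof
  let ?e = "from_nat_into open_normals"
  define U where "U n = carrier G \<inter> \<Inter>(?e ` {..n})" for n
  have ne: "open_normals \<noteq> {}" using carrier_open_normal by blast
  show "U n \<in> open_normals" for n
    unfolding U_def by (rule finite_Inter_open_normal) (use from_nat_into[OF ne] in auto)
  show "decseq U" by (force simp: decseq_def U_def)
  show "\<exists>n. U n \<subseteq> N" if N: "N \<in> open_normals" for N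
  proof -
    obtain n where "?e n = N" using from_nat_into_surj[OF assms N] by blast
    then have "U n \<subseteq> N" by (auto simp: U_def)
    then show ?thesis ..
  qed
qed

text \<open>
  The approximations \<open>K m = U m <#> H m\<close> decrease, and \<open>U n <#> K m = K n\<close> for \<open>m \<ge> n\<close>
  by coherence. For \<open>x \<in> K n\<close> the closed sets \<open>(U n #> x) \<inter> K m\<close> are therefore nonempty
  and nested, and a common point lifts \<open>x\<close> to the intersection of the \<open>K m\<close>.
\<close>
lemma approximation_limit:
  assumes U: "\<And>n. U n \<in> open_normals" "decseq U"
    and H: "\<And>n. H n \<in> closed_subgroups G T"
    and coherent: "\<And>n. U n <#> H (Suc n) = U n <#> H n"
  shows "U n <#> (\<Inter>m. U m <#> H m) = U n <#> H n"
proof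
  define K where "K m = U m <#> H m" for m
  have HG: "H m \<subseteq> carrier G" for m
    using H[of m] subgroup.subset unfolding closed_subgroups_def by blast
  have UG: "U m \<subseteq> carrier G" for m using open_normalsD(5)[OF U(1)] .
  have KG: "K m \<subseteq> carrier G" for m
    unfolding K_def using setmult_subset_G[OF UG HG] .
  have absorb: "U n <#> (U m <#> A) = U n <#> A" if "n \<le> m" "A \<subseteq> carrier G" for n m A
    using set_mult_absorb[OF U(1) U(1)] decseqD[OF U(2)] that by blast
  have KSuc: "K (Suc m) \<subseteq> K m" for m
  proof -
    have "U (Suc m) <#> H (Suc m) \<subseteq> U m <#> H (Suc m)"
      using decseqD[OF U(2), of m "Suc m"] by (intro mono_set_mult) auto
    then show ?thesis by (simp add: K_def coherent)
  qed
  then have "decseq K" by (rule decseq_SucI)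
  have UK: "U n <#> K m = K n" if "n \<le> m" for m
    using that
  proof (induction rule: dec_induct)
    case base show ?case using absorb HG by (simp add: K_def)
  next
    case (step m)
    have "U n <#> K (Suc m) = U n <#> (U m <#> H (Suc m))"
      using absorb step(1) HG by (simp add: K_def)
    also have "\<dots> = U n <#> K m" by (simp add: coherent K_def)
    finally show ?case using step by simp
  qed
  show "U n <#> (\<Inter>m. U m <#> H m) \<subseteq> U n <#> H n"
  proof -
    have "U n <#> (\<Inter>m. K m) \<subseteq> U n <#> K n" by (intro mono_set_mult) auto
    then show ?thesis using UK[of n] by (simp add: K_def)
  qed
  show "U n <#> H n \<subseteq> U n <#> (\<Inter>m. U m <#> H m)"
  proof
    fix x assume "x \<in> U n <#> H n"
    then have x: "x \<in> K n" by (simp add: K_def)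
    have xG: "x \<in> carrier G" using x KG by blast
    define D where "D m = (U n #> x) \<inter> K m" for m
    have "(\<Inter>m. D m) \<noteq> {}"
    proof (rule compact_space_imp_nest[OF compact])
      have "closedin T (K m)" for m
        using set_mult_open_normal_closed_subgroup(1)[OF U(1) H] by (simp add: K_def closed_subgroups_def)
      moreover have "closedin T (U n #> x)"
        using closedin_r_coset[OF open_normalsD(4)[OF U(1)] xG] .
      ultimately show "closedin T (D m)" for m unfolding D_def by (simp add: closedin_Int)
      show "decseq D" using \<open>decseq K\<close> by (fastforce simp: decseq_def D_def)
      show "D m \<noteq> {}" for m
      proof -
        have "x \<in> U n <#> K (max m n)" using x UK[of "max m n"] by simp
        then obtain u k where uk: "u \<in> U n" "k \<in> K (max m n)" "x = u \<otimes> k"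
          by (auto simp: set_mult_def)
        have "u \<in> carrier G" "k \<in> carrier G" using uk UG KG by blast+
        then have "k = inv u \<otimes> x" using uk(3) by (simp add: m_assoc[symmetric])
        then have "k \<in> U n #> x"
          using subgroup.m_inv_closed[OF open_normalsD(2)[OF U(1)] uk(1)] by (auto simp: r_coset_def)
        moreover have "k \<in> K m" using uk(2) decseqD[OF \<open>decseq K\<close>, of m "max m n"] by auto
        ultimately show ?thesis by (auto simp: D_def)
      qed
    qed
    then obtain k u where k: "\<And>m. k \<in> K m" and u: "u \<in> U n" "k = u \<otimes> x"
      by (auto simp: D_def r_coset_def)
    have "u \<in> carrier G" using u UG by blast
    then have "x = inv u \<otimes> k" using u(2) xG by (simp add: m_assoc[symmetric])
    moreover have "inv u \<in> U n"
      using subgroup.m_inv_closed[OF open_normalsD(2)[OF U(1)] u(1)] .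
    ultimately show "x \<in> U n <#> (\<Inter>m. U m <#> H m)"
      using k unfolding set_mult_def[of G "U n"] K_def[symmetric] by blast
  qed
qed

lemma countable_or_continuum:
  assumes count: "countable open_normals" and sub: "\<X> \<subseteq> closed_subgroups G T"
    and limit: "\<And>U H :: nat \<Rightarrow> 'a set. (\<And>n. U n \<in> open_normals) \<Longrightarrow> (\<And>n. H n \<in> \<X>)
                  \<Longrightarrow> (\<Inter>n. U n <#> H n) \<in> \<X>"
    and unc: "uncountable \<X>"
  shows "|UNIV :: nat set set| \<le>o |\<X>|"
proof -
  obtain U where U: "\<And>n. U n \<in> open_normals" "decseq U"
    and cofinal: "\<And>N. N \<in> open_normals \<Longrightarrow> \<exists>n. U n \<subseteq> N"
    using cofinal_sequence[OF count] by blast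
  have XG: "H \<subseteq> carrier G" if "H \<in> \<X>" for H
    using that sub subgroup.subset unfolding closed_subgroups_def by blast
  show ?thesis
  proof (rule cantor_scheme[where E = "\<lambda>n H. U n <#> H"])
    show "U n <#> H = U n <#> K"
      if "H \<in> \<X>" "K \<in> \<X>" "U (Suc n) <#> H = U (Suc n) <#> K" for n H K
    proof -
      have "U (Suc n) \<subseteq> U n" using decseqD[OF U(2), of n "Suc n"] by simp
      then have "U n <#> (U (Suc n) <#> M) = U n <#> M" if "M \<in> \<X>" for M
        using set_mult_absorb[OF U(1) U(1)] XG that by blast
      then show ?thesis using that by metis
    qed
    show "countable ((\<lambda>H. U n <#> H) ` \<X>)" for n
    proof (rule countable_finite, rule finite_subset)
      show "(\<lambda>H. U n <#> H) ` \<X> \<subseteq> {K. subgroup K G \<and> U n \<subseteq> K}"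
      proof (rule image_subsetI)
        fix H assume "H \<in> \<X>"
        then have "H \<in> closed_subgroups G T" using sub by blast
        from set_mult_open_normal_closed_subgroup[OF U(1) this]
        show "U n <#> H \<in> {K. subgroup K G \<and> U n \<subseteq> K}" by (simp add: closed_subgroups_def)
      qed
      show "finite {K. subgroup K G \<and> U n \<subseteq> K}" by (rule finite_overgroups[OF U(1)])
    qed
    show "H = K" if HK: "H \<in> \<X>" "K \<in> \<X>" "\<And>n. U n <#> H = U n <#> K" for H K
    proof -
      have sub_le: "A \<subseteq> B" if AB: "A \<in> \<X>" "B \<in> \<X>" "\<And>n. U n <#> A = U n <#> B" for A B
      proof
        fix x assume x: "x \<in> A"
        show "x \<in> B"
        proof (rule closed_subgroup_approx)
          show "B \<in> closed_subgroups G T" using AB(2) sub by blast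
          show xG: "x \<in> carrier G" using x XG AB(1) by blast
          fix N assume "N \<in> open_normals"
          then obtain n where n: "U n \<subseteq> N" using cofinal by blast
          have "\<one> \<in> U n" using subgroup.one_closed[OF open_normalsD(2)[OF U(1)]] .
          then have "\<one> \<otimes> x \<in> U n <#> A" using x unfolding set_mult_def by blast
          then have "x \<in> U n <#> B" using AB(3) xG by simp
          then show "x \<in> N <#> B" using mono_set_mult[OF n order_refl] by blast
        qed
      qed
      show ?thesis using sub_le[OF HK] sub_le[OF HK(2,1) HK(3)[symmetric]] by blast
    qed
    show "\<exists>K\<in>\<X>. \<forall>n. U n <#> K = U n <#> H n"
      if "\<And>n. H n \<in> \<X>" "\<And>n. U n <#> H (Suc n) = U n <#> H n" for H
    proof (intro bexI allI)
      show "(\<Inter>m. U m <#> H m) \<in> \<X>" using limit[OF U(1) that(1)] .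
      show "U n <#> (\<Inter>m. U m <#> H m) = U n <#> H n" for n
        using that sub by (intro approximation_limit U) auto
    qed
  qed (rule unc)
qed

section \<open>Independent families of open normal subgroups\<close>

definition maximal_below :: "'a set \<Rightarrow> 'a set set" where
  "maximal_below N = {M \<in> open_normals. M \<subset> N \<and>
     (\<forall>Z\<in>open_normals. M \<subseteq> Z \<and> Z \<subseteq> N \<longrightarrow> Z = M \<or> Z = N)}"

lemma finite_above_open_normal: "N \<in> open_normals \<Longrightarrow> finite {M \<in> open_normals. N \<subseteq> M}"
  by (rule finite_subset[OF _ finite_overgroups]) (auto dest: open_normalsD(2))

text \<open>Between \<open>N\<close> and \<open>G\<close> there are finitely many open normal subgroups, so a
  maximal chain from \<open>G\<close> down to \<open>N\<close> is finite.\<close>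
lemma maximal_below_reaches_all:
  assumes "carrier G \<in> Y" "\<And>N. N \<in> open_normals \<Longrightarrow> N \<in> Y \<Longrightarrow> maximal_below N \<subseteq> Y"
  shows "open_normals \<subseteq> Y"
proof
  fix N assume N: "N \<in> open_normals"
  define A where "A = {M \<in> open_normals. N \<subseteq> M} \<inter> Y"
  have "finite A" "A \<noteq> {}"
    using finite_above_open_normal[OF N] carrier_open_normal assms(1) open_normalsD(5)[OF N]
    by (auto simp: A_def)
  then obtain M where M: "M \<in> A" "\<And>Z. Z \<in> A \<Longrightarrow> Z \<subseteq> M \<Longrightarrow> Z = M"
    using finite_has_minimal[of A] by metis
  have "M = N"
  proof (rule ccontr)
    assume "M \<noteq> N"
    define D where "D = {Z \<in> open_normals. N \<subseteq> Z \<and> Z \<subset> M}"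
    have "finite D"
      by (rule finite_subset[OF _ finite_above_open_normal[OF N]]) (auto simp: D_def)
    moreover have "D \<noteq> {}" using M(1) N \<open>M \<noteq> N\<close> by (auto simp: D_def A_def)
    ultimately obtain Z where Z: "Z \<in> D" "\<And>W. W \<in> D \<Longrightarrow> Z \<subseteq> W \<Longrightarrow> Z = W"
      using finite_has_maximal[of D] by metis
    have "Z \<in> maximal_below M"
      using Z by (fastforce simp: maximal_below_def D_def)
    then have "Z \<in> Y" using assms(2) M(1) by (auto simp: A_def)
    then have "Z \<in> A" using Z(1) by (auto simp: A_def D_def)
    then show False using M(2) Z(1) by (auto simp: D_def)
  qed
  then show "N \<in> Y" using M(1) by (simp add: A_def)
qed

text \<open>
  In a modular lattice, meeting with \<open>a \<le> v\<close> turns a cover \<open>y < v\<close> into a cover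
  \<open>a \<sqinter> y < a\<close> or an equality. The proof compares \<open>z <#> y\<close> with \<open>y\<close> and \<open>v\<close>, and
  uses Dedekind's law.
\<close>
lemma maximal_below_Int:
  assumes v: "v \<in> open_normals" and y: "y \<in> maximal_below v"
    and a: "a \<in> open_normals" "a \<subseteq> v"
    and z: "z \<in> open_normals" "a \<inter> y \<subseteq> z" "z \<subseteq> a"
  shows "z \<subseteq> y \<or> z = a"
proof -
  have yL: "y \<in> open_normals" and yv: "y \<subseteq> v" using y by (auto simp: maximal_below_def)
  note Dy = open_normalsD[OF yL] and Dz = open_normalsD[OF z(1)] and Da = open_normalsD[OF a(1)]
  have y_le: "y \<subseteq> z <#> y"
    using subgroup.one_closed[OF Dz(2)] Dy(5) by (force simp: set_mult_def)
  have z_le: "z \<subseteq> z <#> y"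
    using subgroup.one_closed[OF Dy(2)] Dz(5) by (force simp: set_mult_def)
  have "z <#> y \<subseteq> v"
    using mono_set_mult[OF order_trans[OF z(3) a(2)] yv, of G]
      subgroup_mult_id[OF open_normalsD(2)[OF v]] by simp
  then have "z <#> y = y \<or> z <#> y = v"
    using y y_le set_mult_open_normal[OF z(1) yL] by (simp add: maximal_below_def)
  then consider "z <#> y = y" | "z <#> y = v" by blast
  then show ?thesis
  proof cases
    case 1 then show ?thesis using z_le by simp
  next
    case 2
    have "a \<subseteq> z"
    proof
      fix x assume x: "x \<in> a"
      then have "x \<in> z <#> y" using 2 a(2) by blast
      then obtain s t where st: "s \<in> z" "t \<in> y" "x = s \<otimes> t" by (auto simp: set_mult_def)
      then have "s \<in> carrier G" "t \<in> carrier G" using Dz(5) Dy(5) by blast+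
      then have "t = inv s \<otimes> x" using st(3) by (simp add: m_assoc[symmetric])
      then have "t \<in> a"
        using x st(1) z(3) subgroup.m_closed[OF Da(2)] subgroup.m_inv_closed[OF Da(2)] by auto
      then have "t \<in> z" using st(2) z(2) by blast
      then show "x \<in> z" using st subgroup.m_closed[OF Dz(2)] by simp
    qed
    then show ?thesis using z(3) by blast
  qed
qed

lemma compact_Inter_subset_open:
  assumes C: "\<And>C. C \<in> \<C> \<Longrightarrow> closedin T C" and W: "openin T W" "carrier G \<inter> \<Inter>\<C> \<subseteq> W"
  obtains F where "F \<subseteq> \<C>" "finite F" "carrier G \<inter> \<Inter>F \<subseteq> W"
proof -
  let ?D = "insert (topspace T - W) \<C>"
  have "\<forall>C\<in>?D. closedin T C" using C W(1) by blast
  moreover have "\<Inter>?D = {}" using W(2) by auto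
  ultimately obtain F where F: "finite F" "F \<subseteq> ?D" "\<Inter>F = {}"
    using compact unfolding compact_space_fip by metis
  have "carrier G \<inter> \<Inter>(F - {topspace T - W}) \<subseteq> W"
    using F(3) by auto
  with F(1,2) that[of "F - {topspace T - W}"] show ?thesis by blast
qed

text \<open>
  The members of \<open>X\<close> in the filter of open normal subgroups generated by \<open>A \<union> V\<close>. The
  factor \<open>carrier G\<close> gives the empty intersection its proper value.
\<close>
definition span_below :: "'a set set \<Rightarrow> 'a set set \<Rightarrow> 'a set set \<Rightarrow> 'a set set" where
  "span_below V X A = {x \<in> X. \<exists>F \<subseteq> A \<union> V. finite F \<and> carrier G \<inter> \<Inter>F \<subseteq> x}"

text \<open>
  Let \<open>x\<close> contain \<open>a \<inter> y\<close>, where \<open>a\<close> is a finite intersection of members of \<open>A \<union> V\<close> that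
  lies below the \<open>v \<in> V\<close> under which \<open>y\<close> is maximal. By modularity nothing lies strictly
  between \<open>a \<inter> y\<close> and \<open>a\<close>, so \<open>a \<inter> x\<close> is one of the two: either \<open>y\<close> is spanned with the
  help of \<open>x\<close>, or \<open>x\<close> was spanned already.
\<close>
lemma span_below_exchange:
  assumes V: "V \<subseteq> open_normals" and X: "X = \<Union>(maximal_below ` V)"
    and A: "A \<subseteq> X" and xy: "x \<in> X" "y \<in> X"
    and x_in: "x \<in> span_below V X (insert y A)" and x_notin: "x \<notin> span_below V X A"
  shows "y \<in> span_below V X (insert x A)"
proof -
  have XL: "X \<subseteq> open_normals" by (auto simp: X maximal_below_def)
  obtain F where F: "F \<subseteq> insert y A \<union> V" "finite F" "carrier G \<inter> \<Inter>F \<subseteq> x"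
    using x_in by (auto simp: span_below_def)
  obtain v where v: "v \<in> V" "y \<in> maximal_below v" using xy(2) X by blast
  \<comment> \<open>Including \<open>v\<close> ensures \<open>a \<subseteq> v\<close>, so that modularity applies to \<open>a\<close> and \<open>y\<close>.\<close>
  define F' where "F' = insert v (F - {y})"
  define a where "a = carrier G \<inter> \<Inter>F'"
  have F': "F' \<subseteq> A \<union> V" "finite F'" using F v(1) by (auto simp: F'_def)
  have aL: "a \<in> open_normals"
    unfolding a_def using F' A XL V by (intro finite_Inter_open_normal) auto
  have xL: "x \<in> open_normals" using xy(1) XL by blast
  have "a \<inter> y \<subseteq> x" using F(3) by (auto simp: a_def F'_def)
  moreover have "a \<subseteq> v" by (auto simp: a_def F'_def)
  ultimately consider "a \<inter> x \<subseteq> y" | "a \<inter> x = a"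
    using maximal_below_Int[OF subsetD[OF V v(1)] v(2) aL _ Int_open_normal[OF aL xL]] by blast
  then show ?thesis
  proof cases
    case 1
    then have "carrier G \<inter> \<Inter>(insert x F') \<subseteq> y" by (auto simp: a_def)
    then show ?thesis
      using F' xy(2) unfolding span_below_def
      by (intro CollectI conjI exI[of _ "insert x F'"]) auto
  next
    case 2
    then have "carrier G \<inter> \<Inter>F' \<subseteq> x" by (auto simp: a_def)
    then have "x \<in> span_below V X A"
      using F' xy(1) unfolding span_below_def by blast
    then show ?thesis using x_notin by blast
  qed
qed

text \<open>
  The basis \<open>B\<close> of the covers of \<open>V\<close> is large because \<open>B \<union> V\<close> has no more finite
  intersections than elements, and each of them has finitely many open normal subgroups
  above it; these account for all \<open>|L|\<close> covers, while \<open>|V| < |L|\<close>.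
\<close>
lemma independent_open_normals_exist:
  assumes unc: "uncountable open_normals"
  obtains B V where "B \<subseteq> open_normals" "V \<subseteq> open_normals" "|open_normals| \<le>o |B|"
    "\<And>b F. b \<in> B \<Longrightarrow> F \<subseteq> (B - {b}) \<union> V \<Longrightarrow> finite F \<Longrightarrow> \<not> carrier G \<inter> \<Inter>F \<subseteq> b"
proof -
  obtain V where V: "V \<subseteq> open_normals" "|V| <o |open_normals|"
    "|open_normals| \<le>o |\<Union>(maximal_below ` V)|"
  proof (rule small_set_many_successors[of open_normals maximal_below "carrier G"])
    show "maximal_below N \<subseteq> open_normals" for N by (auto simp: maximal_below_def)
    show "open_normals \<subseteq> Y"
      if "carrier G \<in> Y" "\<And>N. N \<in> open_normals \<Longrightarrow> N \<in> Y \<Longrightarrow> maximal_below N \<subseteq> Y" for Y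
      using maximal_below_reaches_all that by blast
  qed (use carrier_open_normal unc in blast)+
  define X where "X = \<Union>(maximal_below ` V)"
  define cl where "cl = span_below V X"
  have XL: "X \<subseteq> open_normals" by (auto simp: X_def maximal_below_def)
  have inf: "infinite open_normals" using unc countable_finite by blast
  obtain B where B: "B \<subseteq> X" "\<And>b. b \<in> B \<Longrightarrow> b \<notin> cl (B - {b})" "X \<subseteq> cl B"
  proof (rule exchange_basis_exists[of cl X])
    show "cl A \<subseteq> cl A'" if "A \<subseteq> A'" for A A'
      unfolding cl_def span_below_def
      using that by (intro Collect_mono) (meson Un_mono order_refl order_trans)
    show "A \<subseteq> cl A" if "A \<subseteq> X" for A
    proof
      fix x assume "x \<in> A"
      then show "x \<in> cl A"
        using that unfolding cl_def span_below_def
        by (intro CollectI conjI exI[of _ "{x}"]) auto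
    qed
    show "\<exists>F\<subseteq>A. finite F \<and> x \<in> cl F" if x: "x \<in> cl A" for A x
    proof -
      obtain F where F: "x \<in> X" "F \<subseteq> A \<union> V" "finite F" "carrier G \<inter> \<Inter>F \<subseteq> x"
        using x by (auto simp: cl_def span_below_def)
      then have "F \<subseteq> (F \<inter> A) \<union> V" by blast
      then have "x \<in> cl (F \<inter> A)" using F unfolding cl_def span_below_def by blast
      then show ?thesis using F(3) by (intro exI[of _ "F \<inter> A"]) auto
    qed
    show "y \<in> cl (insert x A)"
      if "A \<subseteq> X" "x \<in> X" "y \<in> X" "x \<in> cl (insert y A)" "x \<notin> cl A" for A x y
      using span_below_exchange[OF V(1) X_def] that by (simp add: cl_def)
  qed blast
  have BVL: "B \<union> V \<subseteq> open_normals" using B(1) XL V(1) by blast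
  define above where "above F = {M \<in> open_normals. carrier G \<inter> \<Inter>F \<subseteq> M}" for F
  have fin: "finite (above F)" if "F \<in> Fpow (B \<union> V)" for F
    using that BVL finite_Inter_open_normal finite_above_open_normal unfolding above_def Fpow_def by blast
  have X_cover: "X \<subseteq> (\<Union>F \<in> Fpow (B \<union> V). above F)"
  proof
    fix x assume x: "x \<in> X"
    then have "x \<in> cl B" using B(3) by blast
    then obtain F where "F \<subseteq> B \<union> V" "finite F" "carrier G \<inter> \<Inter>F \<subseteq> x"
      by (auto simp: cl_def span_below_def)
    then have "F \<in> Fpow (B \<union> V)" "x \<in> above F"
      using x XL by (auto simp: Fpow_def above_def)
    then show "x \<in> (\<Union>F \<in> Fpow (B \<union> V). above F)" by blast
  qed
  have infX: "infinite X"
    using V(3) inf card_of_ordLeq_finite unfolding X_def by blast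
  have infBV: "infinite (B \<union> V)"
  proof
    assume "finite (B \<union> V)"
    then have "finite (Fpow (B \<union> V))"
      by (intro finite_subset[OF Fpow_subset_Pow]) simp
    then have "finite (\<Union>F \<in> Fpow (B \<union> V). above F)" using fin by (rule finite_UN_I)
    then show False using infX finite_subset[OF X_cover] by blast
  qed
  have "|\<Union>F \<in> Fpow (B \<union> V). above F| \<le>o |B \<union> V|"
  proof (rule card_of_UNION_ordLeq_infinite[OF infBV])
    show "|Fpow (B \<union> V)| \<le>o |B \<union> V|"
      using card_of_Fpow_infinite[OF infBV] ordIso_imp_ordLeq by blast
    show "\<forall>F\<in>Fpow (B \<union> V). |above F| \<le>o |B \<union> V|"
      using fin infBV by (auto intro: countable_ordLeq_infinite countable_finite)
  qed
  then have "|X| \<le>o |B \<union> V|" using card_of_mono1[OF X_cover] ordLeq_transitive by blast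
  then have L_le: "|open_normals| \<le>o |B \<union> V|"
    using V(3) ordLeq_transitive unfolding X_def by blast
  have "|open_normals| \<le>o |B|"
  proof (rule ccontr)
    assume "\<not> ?thesis"
    then have "|B| <o |open_normals|" by simp
    then have "|B \<union> V| <o |open_normals|" using V(2) inf by (intro card_of_Un_ordLess_infinite)
    then show False using L_le not_ordLess_ordLeq by blast
  qed
  moreover have "\<not> carrier G \<inter> \<Inter>F \<subseteq> b" if "b \<in> B" "F \<subseteq> (B - {b}) \<union> V" "finite F" for b F
    using B(1) B(2)[OF that(1)] that unfolding cl_def span_below_def by blast
  ultimately show ?thesis using that V(1) B(1) XL by blast
qed

text \<open>The intersection of \<open>A \<union> V\<close> recovers \<open>A \<subseteq> B\<close>: if it lies in \<open>b \<in> B\<close>, compactness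
  reduces it to a finite intersection, and independence forces \<open>b \<in> A\<close>.\<close>
lemma Pow_open_normals_le_closed_normal_subgroups:
  assumes "uncountable open_normals"
  shows "|Pow open_normals| \<le>o |closed_normal_subgroups G T|"
proof -
  obtain B V where BV: "B \<subseteq> open_normals" "V \<subseteq> open_normals" and le: "|open_normals| \<le>o |B|"
    and indep: "\<And>b F. b \<in> B \<Longrightarrow> F \<subseteq> (B - {b}) \<union> V \<Longrightarrow> finite F \<Longrightarrow> \<not> carrier G \<inter> \<Inter>F \<subseteq> b"
    using independent_open_normals_exist[OF assms] by metis
  define f where "f A = \<Inter>(insert (carrier G) (A \<union> V))" for A
  have sub: "A \<subseteq> A'" if A: "A \<subseteq> B" "A' \<subseteq> B" "f A = f A'" for A A'
  proof (rule ccontr)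
    assume "\<not> A \<subseteq> A'"
    then obtain b where b: "b \<in> A" "b \<notin> A'" by blast
    have bB: "b \<in> B" using b A by blast
    have "f A \<subseteq> b" using b by (auto simp: f_def)
    then have le_b: "carrier G \<inter> \<Inter>(A' \<union> V) \<subseteq> b" using A(3) by (simp add: f_def)
    have cl: "closedin T C" if "C \<in> A' \<union> V" for C
      using that A(2) BV open_normalsD(4) by blast
    have op: "openin T b" using bB BV open_normalsD(3) by blast
    obtain F where F: "F \<subseteq> A' \<union> V" "finite F" "carrier G \<inter> \<Inter>F \<subseteq> b"
      using compact_Inter_subset_open[OF cl op le_b] by blast
    have "F \<subseteq> (B - {b}) \<union> V" using F(1) A(2) b(2) by blast
    then show False using indep[OF bB _ F(2)] F(3) by blast
  qed
  have "|Pow B| \<le>o |closed_normal_subgroups G T|"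
  proof (rule card_of_ordLeqI[of f])
    show "inj_on f (Pow B)"
    proof (rule inj_onI)
      fix A A' assume "A \<in> Pow B" "A' \<in> Pow B" "f A = f A'"
      then show "A = A'" using sub[of A A'] sub[of A' A] by auto
    qed
    fix A assume "A \<in> Pow B"
    then have "insert (carrier G) (A \<union> V) \<subseteq> open_normals"
      using BV carrier_open_normal by blast
    then have "insert (carrier G) (A \<union> V) \<subseteq> closed_normal_subgroups G T"
      using open_normalsD(1,4) unfolding closed_normal_subgroups_def by blast
    then show "f A \<in> closed_normal_subgroups G T"
      unfolding f_def by (rule Inter_closed_normal_subgroups) simp
  qed
  then show ?thesis using card_of_Pow_mono[OF le] ordLeq_transitive by blast
qed

section \<open>The two cardinalities\<close>

text \<open>Stated for an auxiliary set \<open>C\<close> to cover both cases: it is the set of natural numbers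
  if there are countably many open normal subgroups, and the set of all of them otherwise.\<close>
lemma two_power_weight_le:
  assumes "infinite C" "|open_normals| \<le>o |C|" "|Pow C| \<le>o |X|"
  shows "ctwo ^c weight T \<le>o |X|"
proof -
  obtain \<B> where \<B>: "base_of_topology T \<B>" "weight T = |\<B>|"
    using weight_attained by blast
  have "|\<B>| \<le>o |C|" using weight_le_open_normals[OF assms(1,2)] \<B>(2) by simp
  then have "|Pow \<B>| \<le>o |X|"
    using card_of_Pow_mono assms(3) ordLeq_transitive by blast
  then show ?thesis
    unfolding \<B>(2) using ordIso_ordLeq_trans[OF ordIso_symmetric[OF Pow_cexp_ctwo]] by blast
qed

lemma card_closed_subgroups_le:
  assumes "\<X> \<subseteq> closed_subgroups G T"
  shows "|\<X>| \<le>o ctwo ^c weight T"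
proof -
  obtain \<B> where \<B>: "base_of_topology T \<B>" "weight T = |\<B>|"
    using weight_attained by blast
  have "\<X> \<subseteq> {C. closedin T C}" using assms by (auto simp: closed_subgroups_def)
  then have "|\<X>| \<le>o |Pow \<B>|"
    using card_closed_sets_le_Pow_base[OF \<B>(1)] card_of_mono1 ordLeq_transitive by blast
  then show ?thesis
    unfolding \<B>(2) using Pow_cexp_ctwo ordLeq_ordIso_trans by blast
qed

text \<open>The condition \<open>limit\<close> is what the closed subgroups and the closed normal subgroups
  have in common: limits of coherent approximations stay in the family.\<close>
lemma countable_or_two_power_weight:
  assumes X: "closed_normal_subgroups G T \<subseteq> \<X>" "\<X> \<subseteq> closed_subgroups G T"
    and limit: "\<And>U H :: nat \<Rightarrow> 'a set. (\<And>n. U n \<in> open_normals) \<Longrightarrow> (\<And>n. H n \<in> \<X>)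
                  \<Longrightarrow> (\<Inter>n. U n <#> H n) \<in> \<X>"
  shows "countable \<X> \<or> |\<X>| =o ctwo ^c weight T"
proof (cases "countable open_normals")
  case True
  have "|\<X>| =o ctwo ^c weight T" if "uncountable \<X>"
  proof -
    have "|Pow (UNIV :: nat set)| \<le>o |\<X>|"
      using countable_or_continuum[OF True X(2) limit that] by simp
    moreover have "|open_normals| \<le>o |UNIV :: nat set|"
      by (simp add: True countable_ordLeq_infinite)
    ultimately have "ctwo ^c weight T \<le>o |\<X>|"
      by (intro two_power_weight_le[of "UNIV :: nat set"]) auto
    then show ?thesis using card_closed_subgroups_le[OF X(2)] by (simp add: ordIso_iff_ordLeq)
  qed
  then show ?thesis by blast
next
  case False
  have "|Pow open_normals| \<le>o |\<X>|"
    using Pow_open_normals_le_closed_normal_subgroups[OF False] card_of_mono1[OF X(1)]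
    by (rule ordLeq_transitive)
  moreover have "infinite open_normals" using False countable_finite by blast
  ultimately have "ctwo ^c weight T \<le>o |\<X>|"
    by (intro two_power_weight_le[of open_normals]) auto
  then show ?thesis using card_closed_subgroups_le[OF X(2)] by (simp add: ordIso_iff_ordLeq)
qed

end

theorem corollary6p10:
  fixes G :: "('a, 'b) monoid_scheme" and T :: "'a topology"
  assumes "profinite_group G T"
  shows "(countable (closed_subgroups G T) \<or>
            |closed_subgroups G T| =o ctwo ^c weight T) \<and>
         (countable (closed_normal_subgroups G T) \<or>
            |closed_normal_subgroups G T| =o ctwo ^c weight T)"
proof -
  interpret profinite_group G T by fact
  show ?thesis
  proof (intro conjI countable_or_two_power_weight)
    show "(\<Inter>n. U n <#>\<^bsub>G\<^esub> H n) \<in> closed_subgroups G T"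
      if "\<And>n. U n \<in> open_normals" "\<And>n. H n \<in> closed_subgroups G T" for U H :: "nat \<Rightarrow> 'a set"
      using that by (intro Inter_closed_subgroups image_subsetI set_mult_open_normal_closed_subgroup) auto
    show "(\<Inter>n. U n <#>\<^bsub>G\<^esub> H n) \<in> closed_normal_subgroups G T"
      if "\<And>n. U n \<in> open_normals" "\<And>n. H n \<in> closed_normal_subgroups G T" for U H :: "nat \<Rightarrow> 'a set"
      using that by (intro Inter_closed_normal_subgroups image_subsetI set_mult_open_normal_closed_normal) auto
  qed (use closed_normal_subset in auto)
qed

end
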